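(* Let $A,B,C$ be disjoint non-empty finite sets. For $\Gamma\in\mathcal{F}(A)$, $\Gamma'\in\mathcal{F}(B)$ and $b\in A$, put $$\Gamma\nabla_b\Gamma'=\sum_{\substack{\Gamma''\in\mathcal{F}(A\sqcup B\setminus\{b\}),\\ \Gamma''_{\mid B}=\Gamma',\ \Gamma''/B\to b=\Gamma}}\Gamma'',\qquad\Gamma\circ_b\Gamma'=\sum_{\substack{\Gamma''\in\mathcal{F}(A\sqcup B\setminus\{b\}),\\ \Gamma''_{\mid B}=\Gamma',\ \Gamma''/B\to b=\Gamma,\\ B\ \Gamma''\text{-convex}}}\Gamma'',$$ extended bilinearly to the spaces $\mathbf{F}(A)$, $\mathbf{F}(B)$ generated by $\mathcal{F}(A)$, $\mathcal{F}(B)$. For all $\Gamma\in\mathcal{F}(A)$, $\Gamma'\in\mathcal{F}(B)$, $\Gamma''\in\mathcal{F}(C)$, if $b\ne c\in A$: $$(\Gamma\nabla_b\Gamma')\nabla_c\Gamma''=(\Gamma\nabla_c\Gamma'')\nabla_b\Gamma',\qquad(\Gamma\circ_b\Gamma')\circ_c\Gamma''=(\Gamma\circ_c\Gamma'')\circ_b\Gamma'.$$ If $b\in A$ and $c\in B$: $$(\Gamma\nabla_b\Gamma')\nabla_c\Gamma''=\Gamma\nabla_b(\Gamma'\nabla_c\Gamma''),\qquad(\Gamma\circ_b\Gamma')\circ_c\Gamma''=\Gamma\circ_b(\Gamma'\circ_c\Gamma'').$$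
   Context: A Feynman graph $\Gamma$ consists of a finite non-empty set $V(\Gamma)$ of vertices, finite sets $Int(\Gamma)$ (internal edges), $OutExt(\Gamma)$ (outgoing external edges), $InExt(\Gamma)$ (ingoing external edges), a source map $S_\Gamma:Int(\Gamma)\sqcup OutExt(\Gamma)\to V(\Gamma)$ and a target map $T_\Gamma:Int(\Gamma)\sqcup InExt(\Gamma)\to V(\Gamma)$. Two Feynman graphs are equivalent if they have the same vertex set and there are bijections between their sets of internal, outgoing and ingoing edges compatible with sources and targets. Feynman graphs are taken up to equivalence; $\mathcal{F}(A)$ is the set of (classes of) Feynman graphs with vertex set $A$. For $I\subseteq V(\Gamma)$ non-empty, $\Gamma_{\mid I}$ has vertex set $I$, internal edges the internal edges of $\Gamma$ with source and target in $I$, outgoing external edges the outgoing external edges of $\Gamma$ with source in $I$ together with the internal edges of $\Gamma$ with source in $I$ and target not in $I$, ingoing external edges the ingoing external edges of $\Gamma$ with target in $I$ together with the internal edges of $\Gamma$ with source not in $I$ and target in $I$; sources and targets are those of $\Gamma$. For $b\notin V(\Gamma)\setminus I$, $\Gamma/I\to b$ has vertex set $(V(\Gamma)\setminus I)\sqcup\{b\}$, internal edges $Int(\Gamma)\setminus Int(\Gamma_{\mid I})$, the same external edges as $\Gamma$, and sources and targets those of $\Gamma$, with vertices in $I$ replaced by $b$. $I$ is $\Gamma$-convex if for any oriented path $x\to y_1\to\cdots\to y_k\to z$ (of internal edges) in $\Gamma$, $x,z\in I$ implies $y_1,\ldots,y_k\in I$. *)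

theory Defs
  imports Main "HOL-Library.FuncSet" "HOL-Library.Poly_Mapping"
begin

text \<open>Edge sets are finite and graphs are only considered up to equivalence, so edges can be
  taken to be natural numbers without losing any equivalence class.  Values of \<open>source\<close> and
  \<open>target\<close> outside of the edges where they make sense are irrelevant: they are ignored by
  \<open>feynman_equiv\<close>.\<close>

record 'a feynman_graph =
  verts :: "'a set"
  int_edges :: "nat set"
  out_edges :: "nat set"
  in_edges :: "nat set"
  source :: "nat \<Rightarrow> 'a"
  target :: "nat \<Rightarrow> 'a"

text \<open>Internal edges are disjoint from external ones, so that the unions below are the disjoint
  unions on which the source and target maps are defined.\<close>

definition feynman :: "'a feynman_graph \<Rightarrow> bool" where
  "feynman G \<longleftrightarrow>
     finite (verts G) \<and> verts G \<noteq> {} \<and>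
     finite (int_edges G) \<and> finite (out_edges G) \<and> finite (in_edges G) \<and>
     int_edges G \<inter> out_edges G = {} \<and> int_edges G \<inter> in_edges G = {} \<and>
     source G \<in> int_edges G \<union> out_edges G \<rightarrow> verts G \<and>
     target G \<in> int_edges G \<union> in_edges G \<rightarrow> verts G"

definition feynman_equiv :: "'a feynman_graph \<Rightarrow> 'a feynman_graph \<Rightarrow> bool" where
  "feynman_equiv G H \<longleftrightarrow>
     verts G = verts H \<and>
     (\<exists>f g h.
        bij_betw f (int_edges G) (int_edges H) \<and>
        bij_betw g (out_edges G) (out_edges H) \<and>
        bij_betw h (in_edges G) (in_edges H) \<and>
        (\<forall>e\<in>int_edges G. source H (f e) = source G e \<and> target H (f e) = target G e) \<and>
        (\<forall>e\<in>out_edges G. source H (g e) = source G e) \<and>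
        (\<forall>e\<in>in_edges G. target H (h e) = target G e))"

definition feynman_rel :: "('a feynman_graph \<times> 'a feynman_graph) set" where
  "feynman_rel = {(G, H). feynman G \<and> feynman H \<and> feynman_equiv G H}"

type_synonym 'a feynman_class = "'a feynman_graph set"

definition feynman_classes :: "'a set \<Rightarrow> 'a feynman_class set" where
  "feynman_classes A = {G. feynman G \<and> verts G = A} // feynman_rel"

definition restrict_graph :: "'a feynman_graph \<Rightarrow> 'a set \<Rightarrow> 'a feynman_graph" where
  "restrict_graph G I = \<lparr>
     verts = I,
     int_edges = {e \<in> int_edges G. source G e \<in> I \<and> target G e \<in> I},
     out_edges = {e \<in> out_edges G. source G e \<in> I} \<union>
                 {e \<in> int_edges G. source G e \<in> I \<and> target G e \<notin> I},
     in_edges = {e \<in> in_edges G. target G e \<in> I} \<union>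
                {e \<in> int_edges G. source G e \<notin> I \<and> target G e \<in> I},
     source = source G,
     target = target G\<rparr>"

definition contract_graph :: "'a feynman_graph \<Rightarrow> 'a set \<Rightarrow> 'a \<Rightarrow> 'a feynman_graph" where
  "contract_graph G I b = \<lparr>
     verts = (verts G - I) \<union> {b},
     int_edges = int_edges G - int_edges (restrict_graph G I),
     out_edges = out_edges G,
     in_edges = in_edges G,
     source = (\<lambda>e. if source G e \<in> I then b else source G e),
     target = (\<lambda>e. if target G e \<in> I then b else target G e)\<rparr>"

definition int_step :: "'a feynman_graph \<Rightarrow> 'a \<Rightarrow> 'a \<Rightarrow> bool" where
  "int_step G x y \<longleftrightarrow> (\<exists>e\<in>int_edges G. source G e = x \<and> target G e = y)"

definition convex_in :: "'a feynman_graph \<Rightarrow> 'a set \<Rightarrow> bool" where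
  "convex_in G I \<longleftrightarrow>
     (\<forall>x ys z. successively (int_step G) (x # ys @ [z]) \<longrightarrow> x \<in> I \<longrightarrow> z \<in> I \<longrightarrow> set ys \<subseteq> I)"

text \<open>The induced notions on equivalence classes; independence of the representative is
  shown in \<open>class_restrict_eq\<close>, \<open>class_contract_eq\<close> and \<open>class_convex_eq\<close>.\<close>

definition class_restrict :: "'a feynman_class \<Rightarrow> 'a set \<Rightarrow> 'a feynman_class" where
  "class_restrict X I = feynman_rel `` ((\<lambda>G. restrict_graph G I) ` X)"

definition class_contract :: "'a feynman_class \<Rightarrow> 'a set \<Rightarrow> 'a \<Rightarrow> 'a feynman_class" where
  "class_contract X I b = feynman_rel `` ((\<lambda>G. contract_graph G I b) ` X)"

definition class_convex :: "'a feynman_class \<Rightarrow> 'a set \<Rightarrow> bool" where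
  "class_convex X I \<longleftrightarrow> (\<forall>G\<in>X. convex_in G I)"

definition insertions ::
    "'a set \<Rightarrow> 'a set \<Rightarrow> 'a \<Rightarrow> 'a feynman_class \<Rightarrow> 'a feynman_class \<Rightarrow> 'a feynman_class set" where
  "insertions A B b X Y =
     {Z \<in> feynman_classes (A \<union> B - {b}). class_restrict Z B = Y \<and> class_contract Z B b = X}"

definition convex_insertions ::
    "'a set \<Rightarrow> 'a set \<Rightarrow> 'a \<Rightarrow> 'a feynman_class \<Rightarrow> 'a feynman_class \<Rightarrow> 'a feynman_class set" where
  "convex_insertions A B b X Y =
     {Z \<in> feynman_classes (A \<union> B - {b}).
        class_restrict Z B = Y \<and> class_contract Z B b = X \<and> class_convex Z B}"

definition gen :: "'x \<Rightarrow> 'x \<Rightarrow>\<^sub>0 'k::field" where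
  "gen X = Poly_Mapping.single X 1"

definition bilinear_extension ::
    "('x \<Rightarrow> 'y \<Rightarrow> 'z \<Rightarrow>\<^sub>0 'k) \<Rightarrow> ('x \<Rightarrow>\<^sub>0 'k) \<Rightarrow> ('y \<Rightarrow>\<^sub>0 'k) \<Rightarrow> ('z \<Rightarrow>\<^sub>0 'k::field)" where
  "bilinear_extension m x y =
     (\<Sum>X\<in>Poly_Mapping.keys x. \<Sum>Y\<in>Poly_Mapping.keys y.
        Poly_Mapping.map
          ((*) (Poly_Mapping.lookup x X * Poly_Mapping.lookup y Y)) (m X Y))"

text \<open>The sums over \<open>insertions\<close> and \<open>convex_insertions\<close> are sums over finite sets, see
  \<open>finite_insertions\<close> and \<open>finite_convex_insertions\<close> below.\<close>

definition nabla ::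
    "'a set \<Rightarrow> 'a set \<Rightarrow> 'a \<Rightarrow> ('a feynman_class \<Rightarrow>\<^sub>0 'k) \<Rightarrow> ('a feynman_class \<Rightarrow>\<^sub>0 'k) \<Rightarrow>
      ('a feynman_class \<Rightarrow>\<^sub>0 'k::field)" where
  "nabla A B b = bilinear_extension (\<lambda>X Y. \<Sum>Z\<in>insertions A B b X Y. gen Z)"

definition circ ::
    "'a set \<Rightarrow> 'a set \<Rightarrow> 'a \<Rightarrow> ('a feynman_class \<Rightarrow>\<^sub>0 'k) \<Rightarrow> ('a feynman_class \<Rightarrow>\<^sub>0 'k) \<Rightarrow>
      ('a feynman_class \<Rightarrow>\<^sub>0 'k::field)" where
  "circ A B b = bilinear_extension (\<lambda>X Y. \<Sum>Z\<in>convex_insertions A B b X Y. gen Z)"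

lemma feynman_equiv_refl: "feynman_equiv G G"
  unfolding feynman_equiv_def by (intro conjI refl exI[of _ id]) auto

lemma feynman_equiv_sym:
  assumes "feynman_equiv G H" shows "feynman_equiv H G"
proof -
  obtain f g h where *: "verts G = verts H"
      "bij_betw f (int_edges G) (int_edges H)" "bij_betw g (out_edges G) (out_edges H)"
      "bij_betw h (in_edges G) (in_edges H)"
      "\<And>e. e \<in> int_edges G \<Longrightarrow> source H (f e) = source G e \<and> target H (f e) = target G e"
      "\<And>e. e \<in> out_edges G \<Longrightarrow> source H (g e) = source G e"
      "\<And>e. e \<in> in_edges G \<Longrightarrow> target H (h e) = target G e"
    using assms unfolding feynman_equiv_def by blast
  define f' g' h' where "f' = inv_into (int_edges G) f" "g' = inv_into (out_edges G) g"
    "h' = inv_into (in_edges G) h"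
  note ** = bij_betw_inv_into[OF *(2)] bij_betw_inv_into[OF *(3)] bij_betw_inv_into[OF *(4)]
  show ?thesis
    unfolding feynman_equiv_def
  proof (intro conjI exI ballI)
    show "verts H = verts G" using * by simp
    show "bij_betw f' (int_edges H) (int_edges G)" "bij_betw g' (out_edges H) (out_edges G)"
      "bij_betw h' (in_edges H) (in_edges G)" using ** by (simp_all add: f'_g'_h'_def)
  next
    fix e assume e: "e \<in> int_edges H"
    have "f' e \<in> int_edges G" "f (f' e) = e"
      using e **(1) *(2) by (auto simp: f'_g'_h'_def bij_betw_apply bij_betw_inv_into_right)
    then show "source G (f' e) = source H e" "target G (f' e) = target H e"
      using *(5)[of "f' e"] by simp_all
  next
    fix e assume e: "e \<in> out_edges H"
    have "g' e \<in> out_edges G" "g (g' e) = e"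
      using e **(2) *(3) by (auto simp: f'_g'_h'_def bij_betw_apply bij_betw_inv_into_right)
    then show "source G (g' e) = source H e"
      using *(6)[of "g' e"] by simp
  next
    fix e assume e: "e \<in> in_edges H"
    have "h' e \<in> in_edges G" "h (h' e) = e"
      using e **(3) *(4) by (auto simp: f'_g'_h'_def bij_betw_apply bij_betw_inv_into_right)
    then show "target G (h' e) = target H e"
      using *(7)[of "h' e"] by simp
  qed
qed

lemma feynman_equiv_trans:
  assumes "feynman_equiv G H" "feynman_equiv H K" shows "feynman_equiv G K"
proof -
  obtain f g h where *: "verts G = verts H"
      "bij_betw f (int_edges G) (int_edges H)" "bij_betw g (out_edges G) (out_edges H)"
      "bij_betw h (in_edges G) (in_edges H)"
      "\<And>e. e \<in> int_edges G \<Longrightarrow> source H (f e) = source G e \<and> target H (f e) = target G e"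
      "\<And>e. e \<in> out_edges G \<Longrightarrow> source H (g e) = source G e"
      "\<And>e. e \<in> in_edges G \<Longrightarrow> target H (h e) = target G e"
    using assms(1) unfolding feynman_equiv_def by blast
  obtain f' g' h' where **: "verts H = verts K"
      "bij_betw f' (int_edges H) (int_edges K)" "bij_betw g' (out_edges H) (out_edges K)"
      "bij_betw h' (in_edges H) (in_edges K)"
      "\<And>e. e \<in> int_edges H \<Longrightarrow> source K (f' e) = source H e \<and> target K (f' e) = target H e"
      "\<And>e. e \<in> out_edges H \<Longrightarrow> source K (g' e) = source H e"
      "\<And>e. e \<in> in_edges H \<Longrightarrow> target K (h' e) = target H e"
    using assms(2) unfolding feynman_equiv_def by blast
  show ?thesis
    unfolding feynman_equiv_def
  proof (intro conjI exI ballI)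
    show "verts G = verts K" using * ** by simp
    show "bij_betw (f' \<circ> f) (int_edges G) (int_edges K)"
      "bij_betw (g' \<circ> g) (out_edges G) (out_edges K)"
      "bij_betw (h' \<circ> h) (in_edges G) (in_edges K)"
      using * ** by (blast intro: bij_betw_trans)+
  qed (use * ** in \<open>auto simp: bij_betw_apply\<close>)
qed

lemma equiv_feynman_rel: "equiv {G. feynman G} feynman_rel"
proof (rule equivI)
  show "refl_on {G. feynman G} feynman_rel"
    by (auto simp: refl_on_def feynman_rel_def feynman_equiv_refl)
  show "sym feynman_rel"
    by (auto simp: sym_def feynman_rel_def feynman_equiv_sym)
  show "trans feynman_rel"
    by (auto simp: trans_def feynman_rel_def intro: feynman_equiv_trans)
  show "feynman_rel \<subseteq> {G. feynman G} \<times> {G. feynman G}"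
    by (auto simp: feynman_rel_def)
qed

lemma feynman_restrict_graph:
  assumes "feynman G" "I \<subseteq> verts G" "I \<noteq> {}"
  shows "feynman (restrict_graph G I)"
  using assms finite_subset[OF assms(2)] unfolding feynman_def restrict_graph_def
  by (auto simp: Pi_iff)

lemma feynman_contract_graph:
  assumes "feynman G"
  shows "feynman (contract_graph G I b)"
  using assms unfolding feynman_def contract_graph_def
  by (auto simp: Pi_iff)

lemma bij_betw_Collect:
  assumes "bij_betw f A B" "\<And>e. e \<in> A \<Longrightarrow> P e \<longleftrightarrow> Q (f e)"
  shows "bij_betw f {e \<in> A. P e} {e \<in> B. Q e}"
  using assms unfolding bij_betw_def inj_on_def by auto

lemma bij_betw_if_Un:
  assumes "bij_betw f A A'" "bij_betw g B B'" "A \<inter> B = {}" "A' \<inter> B' = {}"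
  shows "bij_betw (\<lambda>e. if e \<in> A then f e else g e) (A \<union> B) (A' \<union> B')"
proof (rule bij_betw_combine)
  show "bij_betw (\<lambda>e. if e \<in> A then f e else g e) A A'"
    using assms(1) by (subst bij_betw_cong[of _ _ f]) auto
  show "bij_betw (\<lambda>e. if e \<in> A then f e else g e) B B'"
    using assms(2,3) by (subst bij_betw_cong[of _ _ g]) auto
qed (use assms in auto)

lemma restrict_graph_equiv:
  assumes "feynman G" "feynman H" "feynman_equiv G H"
  shows "feynman_equiv (restrict_graph G I) (restrict_graph H I)"
proof -
  obtain f g h where *: "verts G = verts H"
      "bij_betw f (int_edges G) (int_edges H)" "bij_betw g (out_edges G) (out_edges H)"
      "bij_betw h (in_edges G) (in_edges H)"
      "\<And>e. e \<in> int_edges G \<Longrightarrow> source H (f e) = source G e \<and> target H (f e) = target G e"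
      "\<And>e. e \<in> out_edges G \<Longrightarrow> source H (g e) = source G e"
      "\<And>e. e \<in> in_edges G \<Longrightarrow> target H (h e) = target G e"
    using assms(3) unfolding feynman_equiv_def by blast
  have d: "int_edges G \<inter> out_edges G = {}" "int_edges G \<inter> in_edges G = {}"
     "int_edges H \<inter> out_edges H = {}" "int_edges H \<inter> in_edges H = {}"
    using assms(1,2) by (auto simp: feynman_def)
  let ?g = "\<lambda>e. if e \<in> {e \<in> out_edges G. source G e \<in> I} then g e else f e"
  let ?h = "\<lambda>e. if e \<in> {e \<in> in_edges G. target G e \<in> I} then h e else f e"
  show ?thesis
    unfolding feynman_equiv_def restrict_graph_def feynman_graph.simps
  proof (intro conjI exI ballI refl)
    show "bij_betw f {e \<in> int_edges G. source G e \<in> I \<and> target G e \<in> I}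
        {e \<in> int_edges H. source H e \<in> I \<and> target H e \<in> I}"
      by (rule bij_betw_Collect) (use * in auto)
    show "bij_betw ?g ({e \<in> out_edges G. source G e \<in> I} \<union>
                 {e \<in> int_edges G. source G e \<in> I \<and> target G e \<notin> I})
                 ({e \<in> out_edges H. source H e \<in> I} \<union>
                 {e \<in> int_edges H. source H e \<in> I \<and> target H e \<notin> I})"
      by (intro bij_betw_if_Un bij_betw_Collect) (use * d in auto)
    show "bij_betw ?h ({e \<in> in_edges G. target G e \<in> I} \<union>
                {e \<in> int_edges G. source G e \<notin> I \<and> target G e \<in> I})
                ({e \<in> in_edges H. target H e \<in> I} \<union>
                {e \<in> int_edges H. source H e \<notin> I \<and> target H e \<in> I})"
      by (intro bij_betw_if_Un bij_betw_Collect) (use * d in auto)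
  qed (use * d in auto)
qed

lemma contract_graph_equiv:
  assumes "feynman_equiv G H"
  shows "feynman_equiv (contract_graph G I b) (contract_graph H I b)"
proof -
  obtain f g h where *: "verts G = verts H"
      "bij_betw f (int_edges G) (int_edges H)" "bij_betw g (out_edges G) (out_edges H)"
      "bij_betw h (in_edges G) (in_edges H)"
      "\<And>e. e \<in> int_edges G \<Longrightarrow> source H (f e) = source G e \<and> target H (f e) = target G e"
      "\<And>e. e \<in> out_edges G \<Longrightarrow> source H (g e) = source G e"
      "\<And>e. e \<in> in_edges G \<Longrightarrow> target H (h e) = target G e"
    using assms unfolding feynman_equiv_def by blast
  have eq: "int_edges K - int_edges (restrict_graph K I) =
     {e \<in> int_edges K. \<not> (source K e \<in> I \<and> target K e \<in> I)}" for K :: "'a feynman_graph"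
    by (auto simp: restrict_graph_def)
  show ?thesis
    unfolding feynman_equiv_def contract_graph_def feynman_graph.simps eq
  proof (intro conjI exI ballI)
    show "bij_betw f {e \<in> int_edges G. \<not> (source G e \<in> I \<and> target G e \<in> I)}
        {e \<in> int_edges H. \<not> (source H e \<in> I \<and> target H e \<in> I)}"
      by (rule bij_betw_Collect) (use * in auto)
  qed (use * in auto)
qed

lemma int_step_equiv: "feynman_equiv G H \<Longrightarrow> int_step G x y \<Longrightarrow> int_step H x y"
proof -
  assume "feynman_equiv G H" and "int_step G x y"
  then obtain f e where "bij_betw f (int_edges G) (int_edges H)"
      and "\<forall>e\<in>int_edges G. source H (f e) = source G e \<and> target H (f e) = target G e"
      and "e \<in> int_edges G" "source G e = x" "target G e = y"
    unfolding feynman_equiv_def int_step_def by blast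
  then show "int_step H x y"
    unfolding int_step_def by (intro bexI[of _ "f e"]) (simp_all add: bij_betw_apply)
qed

lemma convex_in_equiv:
  assumes "feynman_equiv G H"
  shows "convex_in G I \<longleftrightarrow> convex_in H I"
proof -
  have "int_step G = int_step H"
    using int_step_equiv[OF assms] int_step_equiv[OF feynman_equiv_sym[OF assms]]
    by (intro ext iffI)
  then show ?thesis by (simp add: convex_in_def)
qed

lemma class_restrict_eq:
  assumes "feynman G" "I \<subseteq> verts G" "I \<noteq> {}"
  shows "class_restrict (feynman_rel `` {G}) I = feynman_rel `` {restrict_graph G I}"
proof -
  have eq: "feynman_rel `` {restrict_graph H I} = feynman_rel `` {restrict_graph G I}"
    if "(G, H) \<in> feynman_rel" for H
  proof (rule equiv_class_eq[OF equiv_feynman_rel, symmetric])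
    have H: "feynman H" "verts H = verts G" "feynman_equiv G H"
      using that by (auto simp: feynman_rel_def feynman_equiv_def)
    show "(restrict_graph G I, restrict_graph H I) \<in> feynman_rel"
      using H assms feynman_restrict_graph[of G I] feynman_restrict_graph[of H I]
        restrict_graph_equiv[of G H I]
      by (simp add: feynman_rel_def)
  qed
  have "(G, G) \<in> feynman_rel"
    using assms by (simp add: feynman_rel_def feynman_equiv_refl)
  then have ne: "feynman_rel `` {G} \<noteq> {}" by blast
  have "class_restrict (feynman_rel `` {G}) I =
      (\<Union>H\<in>feynman_rel `` {G}. feynman_rel `` {restrict_graph H I})"
    unfolding class_restrict_def by auto
  also have "\<dots> = (\<Union>H\<in>feynman_rel `` {G}. feynman_rel `` {restrict_graph G I})"
    by (intro SUP_cong refl eq) simp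
  also have "\<dots> = feynman_rel `` {restrict_graph G I}"
    using ne by simp
  finally show ?thesis .
qed

lemma class_contract_eq:
  assumes "feynman G"
  shows "class_contract (feynman_rel `` {G}) I b = feynman_rel `` {contract_graph G I b}"
proof -
  have eq: "feynman_rel `` {contract_graph H I b} = feynman_rel `` {contract_graph G I b}"
    if "(G, H) \<in> feynman_rel" for H
  proof (rule equiv_class_eq[OF equiv_feynman_rel, symmetric])
    show "(contract_graph G I b, contract_graph H I b) \<in> feynman_rel"
      using that by (simp add: feynman_rel_def feynman_contract_graph contract_graph_equiv)
  qed
  have "(G, G) \<in> feynman_rel"
    using assms by (simp add: feynman_rel_def feynman_equiv_refl)
  then have ne: "feynman_rel `` {G} \<noteq> {}" by blast
  have "class_contract (feynman_rel `` {G}) I b =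
      (\<Union>H\<in>feynman_rel `` {G}. feynman_rel `` {contract_graph H I b})"
    unfolding class_contract_def by auto
  also have "\<dots> = (\<Union>H\<in>feynman_rel `` {G}. feynman_rel `` {contract_graph G I b})"
    by (intro SUP_cong refl eq) simp
  also have "\<dots> = feynman_rel `` {contract_graph G I b}"
    using ne by simp
  finally show ?thesis .
qed

lemma class_convex_eq:
  assumes "feynman G"
  shows "class_convex (feynman_rel `` {G}) I \<longleftrightarrow> convex_in G I"
proof -
  have "(G, G) \<in> feynman_rel"
    using assms by (simp add: feynman_rel_def feynman_equiv_refl)
  moreover have "convex_in H I \<longleftrightarrow> convex_in G I" if "(G, H) \<in> feynman_rel" for H
    using that convex_in_equiv[of G H] by (simp add: feynman_rel_def)
  ultimately show ?thesis
    unfolding class_convex_def by blast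
qed

lemma normal_form:
  assumes "feynman G" "verts G = V"
    and "card (int_edges G) = i" "card (out_edges G) = p" "card (in_edges G) = q"
  shows "\<exists>s\<in>{..<i+p} \<rightarrow>\<^sub>E V. \<exists>t\<in>{..<i+q} \<rightarrow>\<^sub>E V.
    (G, \<lparr>verts = V, int_edges = {..<i}, out_edges = {i..<i+p}, in_edges = {i..<i+q},
         source = s, target = t\<rparr>) \<in> feynman_rel"
proof -
  have fin: "finite (int_edges G)" "finite (out_edges G)" "finite (in_edges G)"
    and maps: "\<And>e. e \<in> int_edges G \<Longrightarrow> source G e \<in> V \<and> target G e \<in> V"
      "\<And>e. e \<in> out_edges G \<Longrightarrow> source G e \<in> V" "\<And>e. e \<in> in_edges G \<Longrightarrow> target G e \<in> V"
    using assms by (auto simp: feynman_def Pi_iff)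
  obtain f where f: "bij_betw f {..<i} (int_edges G)"
    using finite_same_card_bij[of "{..<i}" "int_edges G"] fin assms by auto
  obtain g where g: "bij_betw g {i..<i+p} (out_edges G)"
    using finite_same_card_bij[of "{i..<i+p}" "out_edges G"] fin assms by auto
  obtain h where h: "bij_betw h {i..<i+q} (in_edges G)"
    using finite_same_card_bij[of "{i..<i+q}" "in_edges G"] fin assms by auto
  define s where "s = (\<lambda>e. if e < i then source G (f e) else if e < i + p then source G (g e)
    else undefined)"
  define t where "t = (\<lambda>e. if e < i then target G (f e) else if e < i + q then target G (h e)
    else undefined)"
  define K where "K = \<lparr>verts = V, int_edges = {..<i}, out_edges = {i..<i+p},
    in_edges = {i..<i+q}, source = s, target = t\<rparr>"
  have s: "s \<in> {..<i+p} \<rightarrow>\<^sub>E V"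
    using maps f g by (auto simp: s_def bij_betw_apply PiE_iff extensional_def)
  have t: "t \<in> {..<i+q} \<rightarrow>\<^sub>E V"
    using maps f h by (auto simp: t_def bij_betw_apply PiE_iff extensional_def)
  have "feynman_equiv K G"
    unfolding feynman_equiv_def
  proof (intro conjI exI ballI)
    show "bij_betw f (int_edges K) (int_edges G)" "bij_betw g (out_edges K) (out_edges G)"
      "bij_betw h (in_edges K) (in_edges G)"
      using f g h by (simp_all add: K_def)
  qed (auto simp: K_def s_def t_def assms)
  moreover have "feynman K"
    using s t assms by (auto simp: feynman_def K_def)
  ultimately have "(G, K) \<in> feynman_rel"
    using assms by (simp add: feynman_rel_def feynman_equiv_sym)
  then show ?thesis using s t unfolding K_def by blast
qed

lemma feynman_equiv_card:
  assumes "feynman_equiv G H"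
  shows "card (int_edges G) = card (int_edges H)" "card (out_edges G) = card (out_edges H)"
    "card (in_edges G) = card (in_edges H)"
  using assms unfolding feynman_equiv_def by (metis bij_betw_same_card)+

lemma feynman_classes_rep:
  assumes "X \<in> feynman_classes A"
  obtains G where "feynman G" "verts G = A" "X = feynman_rel `` {G}"
  using assms by (auto simp: feynman_classes_def elim: quotientE)

lemma finite_insertions:
  assumes "finite A" "finite B" "B \<noteq> {}" "A \<inter> B = {}" "b \<in> A"
    and "X \<in> feynman_classes A" "Y \<in> feynman_classes B"
  shows "finite (insertions A B b X Y)"
proof -
  define V where "V = A \<union> B - {b}"
  obtain G where G: "feynman G" "verts G = A" "X = feynman_rel `` {G}"
    using assms(6) by (rule feynman_classes_rep)
  obtain H where H: "feynman H" "verts H = B" "Y = feynman_rel `` {H}"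
    using assms(7) by (rule feynman_classes_rep)
  define i p q where "i = card (int_edges G) + card (int_edges H)" "p = card (out_edges G)"
    "q = card (in_edges G)"
  let ?F = "\<lambda>(s, t). feynman_rel `` {\<lparr>verts = V, int_edges = {..<i}, out_edges = {i..<i+p},
    in_edges = {i..<i+q}, source = s, target = t\<rparr>}"
  have "insertions A B b X Y \<subseteq> ?F ` (({..<i+p} \<rightarrow>\<^sub>E V) \<times> ({..<i+q} \<rightarrow>\<^sub>E V))"
  proof
    fix Z assume Z: "Z \<in> insertions A B b X Y"
    then have "Z \<in> feynman_classes V" by (simp add: insertions_def V_def)
    then obtain K where K: "feynman K" "verts K = V" "Z = feynman_rel `` {K}"
      by (rule feynman_classes_rep)
    have BV: "B \<subseteq> V" using assms by (auto simp: V_def)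
    have 1: "feynman_rel `` {restrict_graph K B} = feynman_rel `` {H}"
      using Z class_restrict_eq[of K B] K BV assms(3) H by (simp add: insertions_def)
    have 2: "feynman_rel `` {contract_graph K B b} = feynman_rel `` {G}"
      using Z class_contract_eq[of K B b] K G by (simp add: insertions_def)
    have e1: "feynman_equiv (restrict_graph K B) H"
      using eq_equiv_class[OF 1 equiv_feynman_rel] H by (simp add: feynman_rel_def)
    have e2: "feynman_equiv (contract_graph K B b) G"
      using eq_equiv_class[OF 2 equiv_feynman_rel] G by (simp add: feynman_rel_def)
    have fin: "finite (int_edges K)" using K by (simp add: feynman_def)
    have sub: "int_edges (restrict_graph K B) \<subseteq> int_edges K" by (auto simp: restrict_graph_def)
    have "card (int_edges (contract_graph K B b)) =
        card (int_edges K) - card (int_edges (restrict_graph K B))"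
      using sub fin by (simp add: contract_graph_def card_Diff_subset finite_subset)
    then have ci: "card (int_edges K) = i"
      using feynman_equiv_card(1)[OF e1] feynman_equiv_card(1)[OF e2] card_mono[OF fin sub]
      by (simp add: i_p_q_def)
    have cp: "card (out_edges K) = p" and cq: "card (in_edges K) = q"
      using feynman_equiv_card(2,3)[OF e2] by (simp_all add: i_p_q_def contract_graph_def)
    obtain s t where st: "s \<in> {..<i+p} \<rightarrow>\<^sub>E V" "t \<in> {..<i+q} \<rightarrow>\<^sub>E V"
      "(K, \<lparr>verts = V, int_edges = {..<i}, out_edges = {i..<i+p}, in_edges = {i..<i+q},
         source = s, target = t\<rparr>) \<in> feynman_rel"
      using normal_form[OF K(1,2) ci cp cq] by blast
    have "Z = ?F (s, t)"
      using equiv_class_eq[OF equiv_feynman_rel st(3)] K by simp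
    then show "Z \<in> ?F ` (({..<i+p} \<rightarrow>\<^sub>E V) \<times> ({..<i+q} \<rightarrow>\<^sub>E V))"
      using st(1,2) by blast
  qed
  moreover have "finite (({..<i+p} \<rightarrow>\<^sub>E V) \<times> ({..<i+q} \<rightarrow>\<^sub>E V))"
    using assms by (intro finite_cartesian_product finite_PiE) (auto simp: V_def)
  ultimately show ?thesis by (blast intro: finite_subset)
qed

lemma finite_convex_insertions:
  assumes "finite A" "finite B" "B \<noteq> {}" "A \<inter> B = {}" "b \<in> A"
    and "X \<in> feynman_classes A" "Y \<in> feynman_classes B"
  shows "finite (convex_insertions A B b X Y)"
  using finite_insertions[OF assms]
  by (rule rev_finite_subset) (simp add: insertions_def convex_insertions_def Collect_mono)

end

theory Submission
  imports Defs
begin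

text \<open>Both sides are sums of generators over sets of graphs: in an iterated insertion the
  intermediate graph is a contraction or a restriction of the final one, so no graph is
  counted twice.  The sets agree because contractions and restrictions commute.  For the
  convexity conditions, contracting \<open>I\<close> has the same effect on reachability as
  adding all steps inside \<open>I\<close>, and adding these steps does not change whether \<open>I\<close> is convex.\<close>

section \<open>Convex sets of a relation\<close>

text \<open>A walk in a contracted graph need not lift to a walk: it may enter \<open>I\<close> at
  one vertex and leave it from another. Adding the missing jumps keeps the original vertex set, so
  the convexity conditions of both bracketings become conditions on a single relation and the graphs
  can be forgotten. For disjoint sets the danger is that collapsing \<open>J\<close> creates new
  walks that leave \<open>I\<close> and return. Such a walk would meet \<open>J\<close>; closing it
  up inside \<open>I\<close> puts a point of \<open>I\<close> between points of \<open>J\<close>,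
  against the convexity of \<open>J\<close>. For nested sets a convex outer set traps every walk
  between points of the inner one.\<close>

definition convex_wrt :: "('a \<Rightarrow> 'a \<Rightarrow> bool) \<Rightarrow> 'a set \<Rightarrow> bool" where
  "convex_wrt r I \<longleftrightarrow> (\<forall>x y z. r\<^sup>*\<^sup>* x y \<longrightarrow> r\<^sup>*\<^sup>* y z \<longrightarrow> x \<in> I \<longrightarrow> z \<in> I \<longrightarrow> y \<in> I)"

text \<open>All points of \<open>I\<close> become mutually reachable, which gives the reachability
  preorder of the quotient by \<open>I\<close>, pulled back to the original points. No vertex is
  renamed, so several contractions can be compared directly.\<close>

definition clump :: "('a \<Rightarrow> 'a \<Rightarrow> bool) \<Rightarrow> 'a set \<Rightarrow> 'a \<Rightarrow> 'a \<Rightarrow> bool" where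
  "clump r I x y \<longleftrightarrow> r x y \<or> x \<in> I \<and> y \<in> I"

lemma convex_wrtD:
  "convex_wrt r I \<Longrightarrow> r\<^sup>*\<^sup>* x y \<Longrightarrow> r\<^sup>*\<^sup>* y z \<Longrightarrow> x \<in> I \<Longrightarrow> z \<in> I \<Longrightarrow> y \<in> I"
  unfolding convex_wrt_def by blast

lemma convex_wrt_mono:
  assumes "r \<le> s" "convex_wrt s I"
  shows "convex_wrt r I"
  using assms(2) rtranclp_mono[OF assms(1)] unfolding convex_wrt_def by blast

lemma clump_increasing: "r \<le> clump r I"
  by (auto simp: clump_def)

lemma clump_commute: "clump (clump r I) J = clump (clump r J) I"
  by (auto simp: clump_def fun_eq_iff)

lemma clump_mono: "I \<subseteq> J \<Longrightarrow> clump r I \<le> clump r J"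
  by (auto simp: clump_def)

text \<open>Cut the walk after its last jump inside \<open>I\<close>: what follows uses only
  \<open>r\<close> and starts in \<open>I\<close>. Without a jump, \<open>x\<close> itself
  serves.\<close>

lemma clump_reach_from:
  assumes "(clump r I)\<^sup>*\<^sup>* x y" "x \<in> I"
  shows "\<exists>x'\<in>I. r\<^sup>*\<^sup>* x' y"
  using assms
proof (induction rule: rtranclp_induct)
  case (step y z)
  then show ?case
    unfolding clump_def by (blast intro: rtranclp.rtrancl_into_rtrancl)
qed blast

lemma clump_reach_to:
  assumes "(clump r I)\<^sup>*\<^sup>* y z" "z \<in> I"
  shows "\<exists>z'\<in>I. r\<^sup>*\<^sup>* y z'"
  using assms
proof (induction rule: converse_rtranclp_induct)
  case (step x y)
  then show ?case
    unfolding clump_def by (blast intro: converse_rtranclp_into_rtranclp)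
qed blast

text \<open>Cutting the walk to \<open>y\<close> after its last jump and the walk from
  \<open>y\<close> before its first one leaves an \<open>r\<close>-walk through \<open>y\<close>
  with both ends in \<open>I\<close>.\<close>

lemma convex_wrt_clump: "convex_wrt (clump r I) I \<longleftrightarrow> convex_wrt r I"
proof
  assume r: "convex_wrt r I"
  show "convex_wrt (clump r I) I"
    unfolding convex_wrt_def
  proof (intro allI impI)
    fix x y z
    assume "(clump r I)\<^sup>*\<^sup>* x y" "(clump r I)\<^sup>*\<^sup>* y z" "x \<in> I" "z \<in> I"
    then show "y \<in> I"
      using clump_reach_from[of r I x y] clump_reach_to[of r I y z] convex_wrtD[OF r] by blast
  qed
qed (rule convex_wrt_mono[OF clump_increasing])

text \<open>A walk without jumps is an \<open>r\<close>-walk; otherwise a jump starts at a point of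
  \<open>J\<close> on the walk. Reachability on either side of \<open>j\<close> stays clumped, which
  is enough for closing a cycle.\<close>

lemma clump_reach_cases:
  assumes "(clump r J)\<^sup>*\<^sup>* x y"
  shows "r\<^sup>*\<^sup>* x y \<or> (\<exists>j\<in>J. (clump r J)\<^sup>*\<^sup>* x j \<and> (clump r J)\<^sup>*\<^sup>* j y)"
  using assms
proof (induction rule: rtranclp_induct)
  case (step y z)
  show ?case
  proof (cases "y \<in> J \<and> z \<in> J")
    case True
    then show ?thesis using step.hyps by (blast intro: rtranclp.rtrancl_into_rtrancl)
  next
    case False
    then have "r y z" using step.hyps(2) by (auto simp: clump_def)
    then show ?thesis
      using step.IH step.hyps(2) by (blast intro: rtranclp.rtrancl_into_rtrancl)
  qed
qed blast

text \<open>The right-hand side is symmetric in \<open>I\<close> and \<open>J\<close> by \<open>clump_commute\<close>.\<close>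

lemma convex_wrt_disjoint:
  assumes "I \<inter> J = {}"
  shows "convex_wrt r I \<and> convex_wrt (clump r I) J \<longleftrightarrow>
    convex_wrt (clump (clump r I) J) I \<and> convex_wrt (clump (clump r I) J) J"
proof
  let ?R = "clump r I"
  let ?S = "clump ?R J"
  assume *: "convex_wrt r I \<and> convex_wrt ?R J"
  then have R: "convex_wrt ?R I" and S: "convex_wrt ?S J"
    by (simp_all add: convex_wrt_clump)
  have "convex_wrt ?S I"
    unfolding convex_wrt_def
  proof (intro allI impI)
    fix x y z
    assume xy: "?S\<^sup>*\<^sup>* x y" and yz: "?S\<^sup>*\<^sup>* y z" and x: "x \<in> I" and z: "z \<in> I"
    \<comment> \<open>Both ends lie in \<open>I\<close>, so this jump turns the walk from
      \<open>x\<close> to \<open>z\<close> into a cycle. A point \<open>j\<close> of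
      \<open>J\<close> on it would have \<open>x\<close> between \<open>j\<close> and itself, and
      convexity of \<open>J\<close> would put \<open>x\<close> into \<open>J\<close>.\<close>
    have zx: "?S z x" using x z by (simp add: clump_def)
    have no_J: False if "j \<in> J" "?S\<^sup>*\<^sup>* x j" "?S\<^sup>*\<^sup>* j z" for j
    proof -
      have "?S\<^sup>*\<^sup>* j x" using that(3) zx by (rule rtranclp.rtrancl_into_rtrancl)
      then have "x \<in> J" using convex_wrtD[OF S] that(1,2) by blast
      then show False using x assms by blast
    qed
    \<comment> \<open>With \<open>J\<close> avoided, both walks consist of \<open>?R\<close>-steps
      only.\<close>
    have "?R\<^sup>*\<^sup>* x y" "?R\<^sup>*\<^sup>* y z"
      using clump_reach_cases[OF xy] clump_reach_cases[OF yz] no_J xy yz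
      by (meson rtranclp_trans)+
    then show "y \<in> I" using convex_wrtD[OF R] x z by blast
  qed
  with S show "convex_wrt ?S I \<and> convex_wrt ?S J" by blast
next
  assume "convex_wrt (clump (clump r I) J) I \<and> convex_wrt (clump (clump r I) J) J"
  then show "convex_wrt r I \<and> convex_wrt (clump r I) J"
    using convex_wrt_mono[OF clump_increasing] by blast
qed

text \<open>Each vertex of the walk lies between \<open>x\<close> and a later point of
  \<open>D\<close>, so the walk never leaves \<open>D\<close>.\<close>

lemma convex_wrt_restrict_reach:
  assumes "convex_wrt r D" "r\<^sup>*\<^sup>* x y" "x \<in> D" "y \<in> D"
  shows "(\<lambda>u v. r u v \<and> u \<in> D \<and> v \<in> D)\<^sup>*\<^sup>* x y"
  using assms(2-4)
proof (induction rule: rtranclp_induct)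
  case (step y z)
  then have "y \<in> D" using convex_wrtD[OF assms(1), of x y z] by blast
  with step show ?case by (blast intro: rtranclp.rtrancl_into_rtrancl)
qed blast

text \<open>From right to left: \<open>clump r I\<close> lies below \<open>clump r D\<close>, for
  which \<open>D\<close> is still convex; and a walk between points of \<open>I\<close> is trapped
  in the convex set \<open>D\<close>, so it is already a walk of the restricted relation.\<close>

lemma convex_wrt_nested:
  assumes "I \<subseteq> D"
  shows "convex_wrt r I \<and> convex_wrt (clump r I) D \<longleftrightarrow>
    convex_wrt r D \<and> convex_wrt (\<lambda>u v. r u v \<and> u \<in> D \<and> v \<in> D) I"
    (is "?L \<longleftrightarrow> convex_wrt r D \<and> convex_wrt ?r I")
proof
  assume L: ?L
  have "convex_wrt r D" using L convex_wrt_mono[OF clump_increasing] by blast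
  moreover have "convex_wrt ?r I" by (rule convex_wrt_mono[of _ r]) (use L in auto)
  ultimately show "convex_wrt r D \<and> convex_wrt ?r I" ..
next
  assume *: "convex_wrt r D \<and> convex_wrt ?r I"
  then have D: "convex_wrt r D" by blast
  have "convex_wrt (clump r I) D"
    using D by (intro convex_wrt_mono[OF clump_mono[OF assms]]) (simp add: convex_wrt_clump)
  moreover have "convex_wrt r I"
    unfolding convex_wrt_def
  proof (intro allI impI)
    fix x y z
    assume xyz: "r\<^sup>*\<^sup>* x y" "r\<^sup>*\<^sup>* y z" "x \<in> I" "z \<in> I"
    then have "x \<in> D" "y \<in> D" "z \<in> D" using assms convex_wrtD[OF D, of x y z] by auto
    then have "?r\<^sup>*\<^sup>* x y" "?r\<^sup>*\<^sup>* y z"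
      using convex_wrt_restrict_reach[OF D] xyz by blast+
    then show "y \<in> I" using convex_wrtD[OF conjunct2[OF *]] xyz(3,4) by blast
  qed
  ultimately show ?L by blast
qed

section \<open>Convexity in graphs\<close>

lemma successively_imp_rtranclp:
  "successively r (x # ys @ [z]) \<Longrightarrow> y \<in> set (x # ys @ [z]) \<Longrightarrow> r\<^sup>*\<^sup>* x y \<and> r\<^sup>*\<^sup>* y z"
proof (induction ys arbitrary: x y)
  case (Cons w ws)
  then have xw: "r x w" and wz: "successively r (w # ws @ [z])" by auto
  show ?case
  proof (cases "y = x")
    case True
    then show ?thesis
      using xw Cons.IH[OF wz, of z] by (auto intro: converse_rtranclp_into_rtranclp)
  next
    case False
    then show ?thesis
      using xw Cons.IH[OF wz, of y] Cons.prems(2)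
      by (auto intro: converse_rtranclp_into_rtranclp)
  qed
qed auto

lemma tranclp_imp_successively:
  "r\<^sup>+\<^sup>+ x z \<Longrightarrow> \<exists>ys. successively r (x # ys @ [z])"
proof (induction rule: tranclp_induct)
  case (base y)
  then show ?case by (intro exI[of _ "[]"]) simp
next
  case (step y z)
  then obtain ys where ys: "successively r (x # ys @ [y])" by blast
  then have "successively r ((x # ys @ [y]) @ [z])"
    using step.hyps(2) unfolding successively_append_iff by simp
  then show ?case by (intro exI[of _ "ys @ [y]"]) simp
qed

lemma convex_in_iff: "convex_in G I \<longleftrightarrow> convex_wrt (int_step G) I"
proof
  let ?r = "int_step G"
  assume G: "convex_in G I"
  show "convex_wrt ?r I"
    unfolding convex_wrt_def
  proof (intro allI impI)
    fix x y z
    assume *: "?r\<^sup>*\<^sup>* x y" "?r\<^sup>*\<^sup>* y z" "x \<in> I" "z \<in> I"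
    show "y \<in> I"
    proof (cases "x = y \<or> y = z")
      \<comment> \<open>Both halves now have positive length, so \<open>y\<close> is an interior
        entry of the joined list. The reflexive closure adds only the trivial case that
        \<open>y\<close> is an end.\<close>
      case False
      then have "?r\<^sup>+\<^sup>+ x y" "?r\<^sup>+\<^sup>+ y z" using * by (auto dest: rtranclpD)
      then obtain us vs where us: "successively ?r (x # us @ [y])"
          and vs: "successively ?r (y # vs @ [z])"
        using tranclp_imp_successively by metis
      have "successively ?r ((x # us) @ (y # vs @ [z]))"
        using us vs unfolding successively_append_iff[of _ "x # us"]
          append_Cons[symmetric] by simp
      then have "successively ?r (x # (us @ y # vs) @ [z])" by simp
      then have "set (us @ y # vs) \<subseteq> I" using G * unfolding convex_in_def by blast
      then show ?thesis by simp
    qed (use * in auto)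
  qed
next
  assume G: "convex_wrt (int_step G) I"
  show "convex_in G I"
    unfolding convex_in_def
  proof (intro allI impI subsetI)
    fix x ys z y
    assume *: "successively (int_step G) (x # ys @ [z])" "x \<in> I" "z \<in> I" "y \<in> set ys"
    then show "y \<in> I"
      using successively_imp_rtranclp[OF *(1), of y] convex_wrtD[OF G] by auto
  qed
qed

section \<open>Reachability in restricted and contracted graphs\<close>

lemma int_step_verts: "feynman G \<Longrightarrow> int_step G x y \<Longrightarrow> x \<in> verts G \<and> y \<in> verts G"
  by (auto simp: feynman_def int_step_def)

lemma int_step_restrict:
  "int_step (restrict_graph G I) = (\<lambda>x y. int_step G x y \<and> x \<in> I \<and> y \<in> I)"
  by (auto simp: int_step_def restrict_graph_def fun_eq_iff)

lemma int_step_contract: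
  fixes I b
  defines "p \<equiv> \<lambda>x. if x \<in> I then b else x"
  shows "int_step (contract_graph G I b) x y \<longleftrightarrow>
    (\<exists>u v. int_step G u v \<and> \<not> (u \<in> I \<and> v \<in> I) \<and> x = p u \<and> y = p v)"
proof -
  have "source (contract_graph G I b) e = p (source G e)"
    "target (contract_graph G I b) e = p (target G e)" for e
    by (simp_all add: contract_graph_def p_def)
  moreover have "int_edges (contract_graph G I b) =
      {e \<in> int_edges G. \<not> (source G e \<in> I \<and> target G e \<in> I)}"
    by (auto simp: contract_graph_def restrict_graph_def)
  ultimately show ?thesis unfolding int_step_def by auto
qed

text \<open>A jump inside \<open>I\<close> is collapsed by \<open>p\<close>, and any other step
  survives as an edge of the contraction.\<close>

lemma contract_reach:
  fixes I b
  defines "p \<equiv> \<lambda>x. if x \<in> I then b else x"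
  assumes "(clump (int_step G) I)\<^sup>*\<^sup>* x y"
  shows "(int_step (contract_graph G I b))\<^sup>*\<^sup>* (p x) (p y)"
  using assms(2)
proof (induction rule: rtranclp_induct)
  case (step y z)
  have "p y = p z \<or> int_step (contract_graph G I b) (p y) (p z)"
    using step.hyps(2) unfolding int_step_contract clump_def p_def by auto
  with step.IH show ?case by (auto intro: rtranclp.rtrancl_into_rtrancl)
qed blast

text \<open>Edges lift one at a time, but consecutive lifts may meet only after collapsing
  \<open>I\<close>; a jump bridges the gap. The end \<open>y\<close> is an arbitrary preimage, so
  the induction hypothesis can be used at the source of the next lifted edge.\<close>

lemma contract_reach_lift:
  fixes I b
  defines "p \<equiv> \<lambda>x. if x \<in> I then b else x"
  assumes G: "feynman G" and b: "b \<notin> verts G - I"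
    and "(int_step (contract_graph G I b))\<^sup>*\<^sup>* (p x) y'" "x \<in> verts G"
    and "y' = p y" "y \<in> verts G"
  shows "(clump (int_step G) I)\<^sup>*\<^sup>* x y"
  using assms(4,6,7)
proof (induction arbitrary: y rule: rtranclp_induct)
  \<comment> \<open>Since \<open>b\<close> is not a vertex outside \<open>I\<close>, a non-empty
    fibre of \<open>p\<close> on the vertices is a single vertex or all of \<open>I\<close>.\<close>
  have fibre: "(clump (int_step G) I)\<^sup>*\<^sup>* u v"
    if "p u = p v" "u \<in> verts G" "v \<in> verts G" for u v
    using that b by (auto simp: p_def clump_def split: if_splits)
  {
    case base
    then show ?case using fibre assms(5) by blast
  next
    case (step w' y')
    then obtain u v where uv: "int_step G u v" "w' = p u" "y' = p v"
      unfolding int_step_contract p_def by blast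
    then have V: "u \<in> verts G" "v \<in> verts G" using int_step_verts[OF G] by blast+
    have "(clump (int_step G) I)\<^sup>*\<^sup>* x u" using step.IH uv(2) V(1) by blast
    also have "clump (int_step G) I u v" using uv by (simp add: clump_def)
    also have "(clump (int_step G) I)\<^sup>*\<^sup>* v y" using fibre step.prems uv(3) V(2) by simp
    finally show ?case .
  }
qed

lemma convex_contract_iff:
  assumes G: "feynman G" and I: "I \<subseteq> verts G" "I \<noteq> {}" and b: "b \<notin> verts G - I"
    and J: "J \<subseteq> verts G - I \<union> {b}"
  shows "convex_in (contract_graph G I b) J \<longleftrightarrow>
    convex_wrt (clump (int_step G) I) {x \<in> verts G. (if x \<in> I then b else x) \<in> J}"
proof -
  define p where "p = (\<lambda>x. if x \<in> I then b else x)"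
  let ?s = "int_step (contract_graph G I b)"
  let ?R = "clump (int_step G) I"
  \<comment> \<open>The point \<open>b\<close> has a preimage because \<open>I\<close> is
    non-empty.\<close>
  have lift: "\<exists>y\<in>verts G. y' = p y" if "y' \<in> J" for y'
    using that I J by (auto simp: p_def)
  have step_lift: "\<exists>y\<in>verts G. y' = p y" if "?s x' y'" for x' y'
    using that int_step_verts[OF G] unfolding int_step_contract p_def by blast
  have R_verts: "y \<in> verts G" if "?R x y" for x y
    using that int_step_verts[OF G] I by (auto simp: clump_def)
  have "convex_wrt ?s J \<longleftrightarrow> convex_wrt ?R {x \<in> verts G. p x \<in> J}"
  proof
    assume s: "convex_wrt ?s J"
    show "convex_wrt ?R {x \<in> verts G. p x \<in> J}"
      unfolding convex_wrt_def
    proof (intro allI impI)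
      fix x y z
      assume *: "?R\<^sup>*\<^sup>* x y" "?R\<^sup>*\<^sup>* y z"
        "x \<in> {x \<in> verts G. p x \<in> J}" "z \<in> {x \<in> verts G. p x \<in> J}"
      have "p y \<in> J"
        using convex_wrtD[OF s] contract_reach[OF *(1), of b] contract_reach[OF *(2), of b] *(3,4)
        unfolding p_def by blast
      moreover have "y \<in> verts G"
        using *(1,3) R_verts by (cases rule: rtranclp.cases) auto
      ultimately show "y \<in> {x \<in> verts G. p x \<in> J}" by blast
    qed
  next
    assume R: "convex_wrt ?R {x \<in> verts G. p x \<in> J}"
    show "convex_wrt ?s J"
      unfolding convex_wrt_def
    proof (intro allI impI)
      fix x' y' z'
      assume *: "?s\<^sup>*\<^sup>* x' y'" "?s\<^sup>*\<^sup>* y' z'" "x' \<in> J" "z' \<in> J"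
      obtain x where x: "x \<in> verts G" "x' = p x" using lift *(3) by blast
      obtain z where z: "z \<in> verts G" "z' = p z" using lift *(4) by blast
      \<comment> \<open>Either the walk is trivial and \<open>y'\<close> is \<open>x'\<close>, or
        \<open>y'\<close> is the end of a contracted edge; in both cases it has a preimage.\<close>
      obtain y where y: "y \<in> verts G" "y' = p y"
        using *(1) x step_lift by (cases rule: rtranclp.cases) auto
      have "?R\<^sup>*\<^sup>* x y"
        using contract_reach_lift[OF G b, of x y' y] *(1) x y unfolding p_def by blast
      moreover have "?R\<^sup>*\<^sup>* y z"
        using contract_reach_lift[OF G b, of y z' z] *(2) y z unfolding p_def by blast
      ultimately have "y \<in> {x \<in> verts G. p x \<in> J}"
        using convex_wrtD[OF R] *(3,4) x z by blast
      then show "y' \<in> J" using y by blast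
    qed
  qed
  then show ?thesis by (simp add: convex_in_iff p_def)
qed

text \<open>The new vertices avoid \<open>B\<close> and \<open>C\<close>, so the preimages of these
  sets under the collapsing maps are the sets themselves. Both sides then amount to convexity of
  \<open>B\<close> and \<open>C\<close> after clumping both, in either order.\<close>

lemma convex_in_disjoint_commute:
  assumes G: "feynman G" and BC: "B \<subseteq> verts G" "B \<noteq> {}" "C \<subseteq> verts G" "C \<noteq> {}" "B \<inter> C = {}"
    and bc: "b \<notin> verts G" "c \<notin> verts G"
  shows "convex_in G C \<and> convex_in (contract_graph G C c) B \<longleftrightarrow>
    convex_in G B \<and> convex_in (contract_graph G B b) C"
proof -
  have B: "{x \<in> verts G. (if x \<in> C then c else x) \<in> B} = B"
    and C: "{x \<in> verts G. (if x \<in> B then b else x) \<in> C} = C"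
    using BC bc by auto
  have "convex_in (contract_graph G C c) B \<longleftrightarrow> convex_wrt (clump (int_step G) C) B"
    using convex_contract_iff[OF G, of C c B] BC bc unfolding B by blast
  moreover have "convex_in (contract_graph G B b) C \<longleftrightarrow> convex_wrt (clump (int_step G) B) C"
    using convex_contract_iff[OF G, of B b C] BC bc unfolding C by blast
  moreover have "C \<inter> B = {}" using BC by blast
  ultimately show ?thesis
    using convex_wrt_disjoint[of C B "int_step G"] convex_wrt_disjoint[of B C "int_step G"] BC
      clump_commute[of "int_step G" B C]
    unfolding convex_in_iff by auto
qed

text \<open>\<open>D - C \<union> {c}\<close> is the image of \<open>D\<close> under the collapse of
  \<open>C\<close>, and its preimage is again \<open>D\<close>.\<close>

lemma convex_in_nested:
  assumes G: "feynman G" and D: "D \<subseteq> verts G" "C \<subseteq> D" "C \<noteq> {}" and c: "c \<notin> verts G"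
  shows "convex_in G C \<and> convex_in (contract_graph G C c) (D - C \<union> {c}) \<longleftrightarrow>
    convex_in G D \<and> convex_in (restrict_graph G D) C"
proof -
  have "{x \<in> verts G. (if x \<in> C then c else x) \<in> D - C \<union> {c}} = D"
    using D c by auto
  then have "convex_in (contract_graph G C c) (D - C \<union> {c}) \<longleftrightarrow>
      convex_wrt (clump (int_step G) C) D"
    using convex_contract_iff[OF G, of C c "D - C \<union> {c}"] D c by auto
  then show ?thesis
    using convex_wrt_nested[OF D(2), of "int_step G"]
    by (simp add: convex_in_iff int_step_restrict)
qed

section \<open>Commutation of restrictions and contractions\<close>

text \<open>Restriction and contraction never rename edges, so identity bijections suffice; ends
  have to agree only where the graph reads them.\<close>

lemma feynman_equivI:
  assumes "verts G = verts H" "int_edges G = int_edges H" "out_edges G = out_edges H"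
    "in_edges G = in_edges H"
    and "\<And>e. e \<in> int_edges H \<union> out_edges H \<Longrightarrow> source G e = source H e"
    and "\<And>e. e \<in> int_edges H \<union> in_edges H \<Longrightarrow> target G e = target H e"
  shows "feynman_equiv G H"
  unfolding feynman_equiv_def using assms by (intro conjI exI[of _ id]) auto

text \<open>An internal edge between \<open>B\<close> and \<open>C\<close> has \<open>c\<close> as
  its other end after the contraction, and it is external in the restriction either way. Only its
  ignored end changes.\<close>

lemma restrict_contract_disjoint:
  assumes "B \<inter> C = {}" "c \<notin> B"
  shows "feynman_equiv (restrict_graph (contract_graph G C c) B) (restrict_graph G B)"
  using assms
  by (intro feynman_equivI) (auto simp: restrict_graph_def contract_graph_def split: if_splits)

text \<open>\<open>c \<notin> B\<close> and \<open>b \<notin> C\<close> keep the second contraction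
  from absorbing the vertex made by the first.\<close>

lemma contract_contract_disjoint:
  assumes "B \<inter> C = {}" "c \<notin> B" "b \<notin> C" "b \<noteq> c"
  shows "contract_graph (contract_graph G C c) B b = contract_graph (contract_graph G B b) C c"
  using assms by (auto simp: restrict_graph_def contract_graph_def fun_eq_iff)

lemma restrict_restrict:
  assumes "C \<subseteq> D"
  shows "restrict_graph (restrict_graph G D) C = restrict_graph G C"
  using assms by (auto simp: restrict_graph_def)

lemma feynman_ends:
  assumes "feynman G"
  shows "e \<in> int_edges G \<Longrightarrow> source G e \<in> verts G" "e \<in> int_edges G \<Longrightarrow> target G e \<in> verts G"
    "e \<in> out_edges G \<Longrightarrow> source G e \<in> verts G" "e \<in> in_edges G \<Longrightarrow> target G e \<in> verts G"
  using assms by (auto simp: feynman_def)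

text \<open>An end equal to \<open>c\<close> after the contraction must come from \<open>C\<close>:
  ends of actual edges are vertices by \<open>feynman_ends\<close>, and \<open>c\<close> is not
  one.\<close>

lemma restrict_contract_nested:
  assumes "feynman G" "C \<subseteq> D" "c \<notin> verts G"
  shows "feynman_equiv (restrict_graph (contract_graph G C c) (D - C \<union> {c}))
    (contract_graph (restrict_graph G D) C c)"
  using assms(2,3)
  by (intro feynman_equivI)
    (auto simp: restrict_graph_def contract_graph_def feynman_ends[OF assms(1)] split: if_splits)

text \<open>Equality may fail: a \<open>source\<close> or \<open>target\<close> value that the graph
  ignores may be \<open>c\<close>, and then the iterated contraction sends it to \<open>b\<close>
  while the direct one need not.\<close>

lemma contract_contract_nested:
  assumes "feynman G" "C \<subseteq> D" "c \<notin> verts G"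
  shows "feynman_equiv (contract_graph (contract_graph G C c) (D - C \<union> {c}) b)
    (contract_graph G D b)"
  using assms(2,3)
  by (intro feynman_equivI)
    (auto simp: restrict_graph_def contract_graph_def feynman_ends[OF assms(1)] split: if_splits)

section \<open>Passage to equivalence classes\<close>

lemma class_eqI:
  "feynman G \<Longrightarrow> feynman H \<Longrightarrow> feynman_equiv G H \<Longrightarrow> feynman_rel `` {G} = feynman_rel `` {H}"
  by (rule equiv_class_eq[OF equiv_feynman_rel]) (simp add: feynman_rel_def)

lemma feynman_classI:
  "feynman G \<Longrightarrow> verts G = A \<Longrightarrow> feynman_rel `` {G} \<in> feynman_classes A"
  by (auto simp: feynman_classes_def intro: quotientI)

lemma verts_restrict_graph [simp]: "verts (restrict_graph G I) = I"
  by (simp add: restrict_graph_def)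

lemma verts_contract_graph [simp]: "verts (contract_graph G I b) = verts G - I \<union> {b}"
  by (simp add: contract_graph_def)

lemma class_restrict_mem:
  assumes "Z \<in> feynman_classes V" "I \<subseteq> V" "I \<noteq> {}"
  shows "class_restrict Z I \<in> feynman_classes I"
  using assms(1)
proof (rule feynman_classes_rep)
  fix G assume "feynman G" "verts G = V" "Z = feynman_rel `` {G}"
  then show ?thesis
    using assms(2,3)
    by (simp add: class_restrict_eq feynman_classI feynman_restrict_graph)
qed

lemma class_contract_mem:
  assumes "Z \<in> feynman_classes V"
  shows "class_contract Z I b \<in> feynman_classes (V - I \<union> {b})"
  using assms
proof (rule feynman_classes_rep)
  fix G assume "feynman G" "verts G = V" "Z = feynman_rel `` {G}"
  then show ?thesis
    by (simp add: class_contract_eq feynman_classI feynman_contract_graph)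
qed

lemma class_disjoint:
  assumes Z: "Z \<in> feynman_classes V"
    and BC: "B \<subseteq> V" "B \<noteq> {}" "C \<subseteq> V" "C \<noteq> {}" "B \<inter> C = {}"
    and bc: "b \<notin> V" "c \<notin> V" "b \<noteq> c"
  shows "class_restrict (class_contract Z C c) B = class_restrict Z B"
    and "class_contract (class_contract Z C c) B b = class_contract (class_contract Z B b) C c"
    and "class_convex Z C \<and> class_convex (class_contract Z C c) B \<longleftrightarrow>
      class_convex Z B \<and> class_convex (class_contract Z B b) C"
proof -
  obtain G where G: "feynman G" "verts G = V" "Z = feynman_rel `` {G}"
    using Z by (rule feynman_classes_rep)
  have *: "c \<notin> B" "b \<notin> C" "B \<subseteq> V - C \<union> {c}" using BC bc by auto
  show "class_restrict (class_contract Z C c) B = class_restrict Z B"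
    using G BC * class_eqI[OF _ _ restrict_contract_disjoint[OF BC(5) *(1)]]
    by (simp add: class_contract_eq class_restrict_eq feynman_contract_graph
        feynman_restrict_graph)
  show "class_contract (class_contract Z C c) B b = class_contract (class_contract Z B b) C c"
    using G contract_contract_disjoint[OF BC(5) *(1,2) bc(3)]
    by (simp add: class_contract_eq feynman_contract_graph)
  show "class_convex Z C \<and> class_convex (class_contract Z C c) B \<longleftrightarrow>
      class_convex Z B \<and> class_convex (class_contract Z B b) C"
    using G BC bc convex_in_disjoint_commute[of G B C b c]
    by (simp add: class_contract_eq class_convex_eq feynman_contract_graph)
qed

text \<open>Meant for \<open>D = B \<union> C - {c}\<close>, where \<open>D - C \<union> {c}\<close>
  is the middle set \<open>B\<close>. The identities match the conditions for inserting into the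
  middle graph after or before it is itself inserted.\<close>

lemma class_nested:
  assumes Z: "Z \<in> feynman_classes V"
    and D: "D \<subseteq> V" "C \<subseteq> D" "C \<noteq> {}" and c: "c \<notin> V"
  shows "class_restrict (class_restrict Z D) C = class_restrict Z C"
    and "class_restrict (class_contract Z C c) (D - C \<union> {c}) = class_contract (class_restrict Z D) C c"
    and "class_contract (class_contract Z C c) (D - C \<union> {c}) b = class_contract Z D b"
    and "class_convex Z C \<and> class_convex (class_contract Z C c) (D - C \<union> {c}) \<longleftrightarrow>
      class_convex Z D \<and> class_convex (class_restrict Z D) C"
proof -
  obtain G where G: "feynman G" "verts G = V" "Z = feynman_rel `` {G}"
    using Z by (rule feynman_classes_rep)
  have ne: "D \<noteq> {}" "C \<subseteq> V" using D by auto
  have sub: "D - C \<union> {c} \<subseteq> V - C \<union> {c}" using D by auto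
  note eqs = class_contract_eq class_restrict_eq class_convex_eq feynman_contract_graph
    feynman_restrict_graph
  show "class_restrict (class_restrict Z D) C = class_restrict Z C"
    using G D ne by (simp add: eqs restrict_restrict)
  have "feynman (restrict_graph (contract_graph G C c) (D - C \<union> {c}))"
    using G sub by (intro feynman_restrict_graph feynman_contract_graph) auto
  moreover have "feynman (contract_graph (restrict_graph G D) C c)"
    using G D ne by (intro feynman_restrict_graph feynman_contract_graph) auto
  moreover have "class_restrict (class_contract Z C c) (D - C \<union> {c}) =
      feynman_rel `` {restrict_graph (contract_graph G C c) (D - C \<union> {c})}"
    unfolding G(3) class_contract_eq[OF G(1)]
    using G sub by (intro class_restrict_eq feynman_contract_graph) auto
  moreover have "class_contract (class_restrict Z D) C c =
      feynman_rel `` {contract_graph (restrict_graph G D) C c}"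
    using G D ne by (simp add: eqs)
  ultimately show "class_restrict (class_contract Z C c) (D - C \<union> {c}) =
      class_contract (class_restrict Z D) C c"
    using class_eqI restrict_contract_nested[of G C D c] G D c by simp
  show "class_contract (class_contract Z C c) (D - C \<union> {c}) b = class_contract Z D b"
    using class_eqI[OF _ _ contract_contract_nested[of G C D c b]] G D c
    by (simp add: eqs)
  show "class_convex Z C \<and> class_convex (class_contract Z C c) (D - C \<union> {c}) \<longleftrightarrow>
      class_convex Z D \<and> class_convex (class_restrict Z D) C"
    using convex_in_nested[of G D C c] G D c ne by (simp add: eqs)
qed

section \<open>Bilinear extensions on sums of generators\<close>

lemma lookup_sum_gen:
  assumes "finite S"
  shows "Poly_Mapping.lookup (\<Sum>X\<in>S. gen X :: 'x \<Rightarrow>\<^sub>0 'k::field) Y = (if Y \<in> S then 1 else 0)"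
  using assms
  by (simp add: Poly_Mapping.lookup_sum gen_def Poly_Mapping.lookup_single when_def)

lemma keys_sum_gen:
  assumes "finite S"
  shows "Poly_Mapping.keys (\<Sum>X\<in>S. gen X :: 'x \<Rightarrow>\<^sub>0 'k::field) = S"
  using assms by (auto simp: in_keys_iff lookup_sum_gen split: if_splits)

lemma map_times_one: "Poly_Mapping.map ((*) (1::'k::field)) m = m"
  by (rule poly_mapping_eqI) (simp add: Poly_Mapping.map.rep_eq when_def)

text \<open>On sums of distinct generators the keys are the index sets and every coefficient is
  \<open>1\<close>, so the scalars drop out.\<close>

lemma bilinear_extension_sum_gen:
  assumes "finite S" "finite T"
  shows "bilinear_extension m (\<Sum>X\<in>S. gen X) (\<Sum>Y\<in>T. gen Y) = (\<Sum>X\<in>S. \<Sum>Y\<in>T. m X Y)"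
  unfolding bilinear_extension_def
  using assms by (simp add: keys_sum_gen lookup_sum_gen map_times_one)

lemma bilinear_extension_gen: "bilinear_extension m (gen X) (gen Y) = m X Y"
  using bilinear_extension_sum_gen[of "{X}" "{Y}" m] by simp

lemma bilinear_extension_sum_gen_left:
  assumes "finite S" "\<And>X. X \<in> S \<Longrightarrow> finite (I X Y)"
    and "\<And>X X'. X \<noteq> X' \<Longrightarrow> I X Y \<inter> I X' Y = {}"
  shows "bilinear_extension (\<lambda>X Y. \<Sum>Z\<in>I X Y. gen Z) (\<Sum>X\<in>S. gen X) (gen Y) =
    (\<Sum>Z\<in>(\<Union>X\<in>S. I X Y). gen Z)"
  using bilinear_extension_sum_gen[of S "{Y}" "\<lambda>X Y. \<Sum>Z\<in>I X Y. gen Z"] assms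
  by (simp add: sum.UNION_disjoint)

lemma bilinear_extension_sum_gen_right:
  assumes "finite S" "\<And>Y. Y \<in> S \<Longrightarrow> finite (I X Y)"
    and "\<And>Y Y'. Y \<noteq> Y' \<Longrightarrow> I X Y \<inter> I X Y' = {}"
  shows "bilinear_extension (\<lambda>X Y. \<Sum>Z\<in>I X Y. gen Z) (gen X) (\<Sum>Y\<in>S. gen Y) =
    (\<Sum>Z\<in>(\<Union>Y\<in>S. I X Y). gen Z)"
  using bilinear_extension_sum_gen[of "{X}" S "\<lambda>X Y. \<Sum>Z\<in>I X Y. gen Z"] assms
  by (simp add: sum.UNION_disjoint)

section \<open>Iterated insertions\<close>

lemma insertions_mem:
  "Z \<in> insertions A B b X Y \<Longrightarrow> Z \<in> feynman_classes (A \<union> B - {b})"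
  by (simp add: insertions_def)

lemma convex_insertions_subset: "convex_insertions A B b X Y \<subseteq> insertions A B b X Y"
  by (auto simp: insertions_def convex_insertions_def)

lemma nabla_nabla_left:
  assumes "finite A" "finite B" "B \<noteq> {}" "A \<inter> B = {}" "b \<in> A"
    and "finite C" "C \<noteq> {}" "(A \<union> B - {b}) \<inter> C = {}" "c \<in> A \<union> B - {b}"
    and "X \<in> feynman_classes A" "Y \<in> feynman_classes B" "W \<in> feynman_classes C"
  shows "nabla (A \<union> B - {b}) C c (nabla A B b (gen X) (gen Y)) (gen W) =
    (\<Sum>Z\<in>(\<Union>U\<in>insertions A B b X Y. insertions (A \<union> B - {b}) C c U W). gen Z)"
    and "circ (A \<union> B - {b}) C c (circ A B b (gen X) (gen Y)) (gen W) =
    (\<Sum>Z\<in>(\<Union>U\<in>convex_insertions A B b X Y. convex_insertions (A \<union> B - {b}) C c U W). gen Z)"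
proof -
  have 1: "finite (insertions A B b X Y)" "finite (convex_insertions A B b X Y)"
    using assms by (simp_all add: finite_insertions finite_convex_insertions)
  have 2: "finite (insertions (A \<union> B - {b}) C c U W)"
      "finite (convex_insertions (A \<union> B - {b}) C c U W)"
    if "U \<in> insertions A B b X Y" for U
    using assms insertions_mem[OF that]
    by (simp_all add: finite_insertions finite_convex_insertions)
  show "nabla (A \<union> B - {b}) C c (nabla A B b (gen X) (gen Y)) (gen W) =
    (\<Sum>Z\<in>(\<Union>U\<in>insertions A B b X Y. insertions (A \<union> B - {b}) C c U W). gen Z)"
    unfolding nabla_def bilinear_extension_gen
    by (rule bilinear_extension_sum_gen_left[where I = "insertions (A \<union> B - {b}) C c"])
      (use 1 2 in \<open>auto simp: insertions_def\<close>)
  show "circ (A \<union> B - {b}) C c (circ A B b (gen X) (gen Y)) (gen W) =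
    (\<Sum>Z\<in>(\<Union>U\<in>convex_insertions A B b X Y. convex_insertions (A \<union> B - {b}) C c U W). gen Z)"
    unfolding circ_def bilinear_extension_gen
    by (rule bilinear_extension_sum_gen_left[where I = "convex_insertions (A \<union> B - {b}) C c"])
      (use 1(2) 2(2)[OF subsetD[OF convex_insertions_subset]] in
        \<open>auto simp: convex_insertions_def\<close>)
qed

lemma nabla_nabla_right:
  assumes "finite B" "finite C" "C \<noteq> {}" "B \<inter> C = {}" "c \<in> B"
    and "finite A" "B \<union> C - {c} \<noteq> {}" "A \<inter> (B \<union> C - {c}) = {}" "b \<in> A"
    and "X \<in> feynman_classes A" "Y \<in> feynman_classes B" "W \<in> feynman_classes C"
  shows "nabla A (B \<union> C - {c}) b (gen X) (nabla B C c (gen Y) (gen W)) =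
    (\<Sum>Z\<in>(\<Union>U\<in>insertions B C c Y W. insertions A (B \<union> C - {c}) b X U). gen Z)"
    and "circ A (B \<union> C - {c}) b (gen X) (circ B C c (gen Y) (gen W)) =
    (\<Sum>Z\<in>(\<Union>U\<in>convex_insertions B C c Y W. convex_insertions A (B \<union> C - {c}) b X U). gen Z)"
proof -
  have 1: "finite (insertions B C c Y W)" "finite (convex_insertions B C c Y W)"
    using assms by (simp_all add: finite_insertions finite_convex_insertions)
  have 2: "finite (insertions A (B \<union> C - {c}) b X U)"
      "finite (convex_insertions A (B \<union> C - {c}) b X U)"
    if "U \<in> insertions B C c Y W" for U
    using finite_insertions[OF assms(6) _ assms(7-10) insertions_mem[OF that]]
      finite_convex_insertions[OF assms(6) _ assms(7-10) insertions_mem[OF that]] assms(1,2)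
    by blast+
  show "nabla A (B \<union> C - {c}) b (gen X) (nabla B C c (gen Y) (gen W)) =
    (\<Sum>Z\<in>(\<Union>U\<in>insertions B C c Y W. insertions A (B \<union> C - {c}) b X U). gen Z)"
    unfolding nabla_def bilinear_extension_gen
    by (rule bilinear_extension_sum_gen_right[where I = "insertions A (B \<union> C - {c}) b"])
      (use 1 2 in \<open>auto simp: insertions_def\<close>)
  show "circ A (B \<union> C - {c}) b (gen X) (circ B C c (gen Y) (gen W)) =
    (\<Sum>Z\<in>(\<Union>U\<in>convex_insertions B C c Y W. convex_insertions A (B \<union> C - {c}) b X U). gen Z)"
    unfolding circ_def bilinear_extension_gen
    by (rule bilinear_extension_sum_gen_right[where I = "convex_insertions A (B \<union> C - {c}) b"])
      (use 1(2) 2(2)[OF subsetD[OF convex_insertions_subset]] in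
        \<open>auto simp: convex_insertions_def\<close>)
qed

text \<open>The union over \<open>U\<close> collapses, since \<open>U\<close> can only be
  \<open>class_contract Z C c\<close>; it remains to check that this class has the right vertex set.
  The two convexity conditions stay grouped in the shape of the equivalences in
  \<open>class_disjoint\<close> and \<open>class_nested\<close>.\<close>

lemma iterated_insertions_left:
  assumes "(A \<union> B - {b}) \<inter> C = {}" "c \<in> A \<union> B - {b}"
  shows "(\<Union>U\<in>insertions A B b X Y. insertions (A \<union> B - {b}) C c U W) =
      {Z \<in> feynman_classes (A \<union> B - {b} \<union> C - {c}). class_restrict Z C = W \<and>
        class_restrict (class_contract Z C c) B = Y \<and>
        class_contract (class_contract Z C c) B b = X}"
    and "(\<Union>U\<in>convex_insertions A B b X Y. convex_insertions (A \<union> B - {b}) C c U W) =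
      {Z \<in> feynman_classes (A \<union> B - {b} \<union> C - {c}). class_restrict Z C = W \<and>
        class_restrict (class_contract Z C c) B = Y \<and>
        class_contract (class_contract Z C c) B b = X \<and>
        (class_convex Z C \<and> class_convex (class_contract Z C c) B)}"
proof -
  have "A \<union> B - {b} \<union> C - {c} - C \<union> {c} = A \<union> B - {b}" using assms by blast
  then have "class_contract Z C c \<in> feynman_classes (A \<union> B - {b})"
    if "Z \<in> feynman_classes (A \<union> B - {b} \<union> C - {c})" for Z
    using class_contract_mem[OF that, of C c] by simp
  then show "(\<Union>U\<in>insertions A B b X Y. insertions (A \<union> B - {b}) C c U W) =
      {Z \<in> feynman_classes (A \<union> B - {b} \<union> C - {c}). class_restrict Z C = W \<and>
        class_restrict (class_contract Z C c) B = Y \<and>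
        class_contract (class_contract Z C c) B b = X}"
    and "(\<Union>U\<in>convex_insertions A B b X Y. convex_insertions (A \<union> B - {b}) C c U W) =
      {Z \<in> feynman_classes (A \<union> B - {b} \<union> C - {c}). class_restrict Z C = W \<and>
        class_restrict (class_contract Z C c) B = Y \<and>
        class_contract (class_contract Z C c) B b = X \<and>
        (class_convex Z C \<and> class_convex (class_contract Z C c) B)}"
    by (auto simp: insertions_def convex_insertions_def)
qed

text \<open>Here \<open>U\<close> can only be the restriction of \<open>Z\<close> to
  \<open>B \<union> C - {c}\<close>, a set that survives the removal of \<open>b\<close> because it
  is disjoint from \<open>A\<close>.\<close>

lemma iterated_insertions_right:
  assumes "A \<inter> (B \<union> C - {c}) = {}" "b \<in> A" "B \<union> C - {c} \<noteq> {}"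
  shows "(\<Union>U\<in>insertions B C c Y W. insertions A (B \<union> C - {c}) b X U) =
      {Z \<in> feynman_classes (A \<union> (B \<union> C - {c}) - {b}).
        class_restrict (class_restrict Z (B \<union> C - {c})) C = W \<and>
        class_contract (class_restrict Z (B \<union> C - {c})) C c = Y \<and>
        class_contract Z (B \<union> C - {c}) b = X}"
    and "(\<Union>U\<in>convex_insertions B C c Y W. convex_insertions A (B \<union> C - {c}) b X U) =
      {Z \<in> feynman_classes (A \<union> (B \<union> C - {c}) - {b}).
        class_restrict (class_restrict Z (B \<union> C - {c})) C = W \<and>
        class_contract (class_restrict Z (B \<union> C - {c})) C c = Y \<and>
        class_contract Z (B \<union> C - {c}) b = X \<and>
        (class_convex Z (B \<union> C - {c}) \<and> class_convex (class_restrict Z (B \<union> C - {c})) C)}"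
proof -
  have "B \<union> C - {c} \<subseteq> A \<union> (B \<union> C - {c}) - {b}" using assms by blast
  then have "class_restrict Z (B \<union> C - {c}) \<in> feynman_classes (B \<union> C - {c})"
    if "Z \<in> feynman_classes (A \<union> (B \<union> C - {c}) - {b})" for Z
    using class_restrict_mem[OF that] assms(3) by blast
  then show "(\<Union>U\<in>insertions B C c Y W. insertions A (B \<union> C - {c}) b X U) =
      {Z \<in> feynman_classes (A \<union> (B \<union> C - {c}) - {b}).
        class_restrict (class_restrict Z (B \<union> C - {c})) C = W \<and>
        class_contract (class_restrict Z (B \<union> C - {c})) C c = Y \<and>
        class_contract Z (B \<union> C - {c}) b = X}"
    and "(\<Union>U\<in>convex_insertions B C c Y W. convex_insertions A (B \<union> C - {c}) b X U) =
      {Z \<in> feynman_classes (A \<union> (B \<union> C - {c}) - {b}).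
        class_restrict (class_restrict Z (B \<union> C - {c})) C = W \<and>
        class_contract (class_restrict Z (B \<union> C - {c})) C c = Y \<and>
        class_contract Z (B \<union> C - {c}) b = X \<and>
        (class_convex Z (B \<union> C - {c}) \<and> class_convex (class_restrict Z (B \<union> C - {c})) C)}"
    by (auto simp: insertions_def convex_insertions_def)
qed

theorem proposition66:
  fixes A B C :: "'a set"
    and \<Gamma> \<Gamma>' \<Gamma>'' :: "'a feynman_class"
    and b c :: 'a
  assumes "finite A" "A \<noteq> {}" "finite B" "B \<noteq> {}" "finite C" "C \<noteq> {}"
    and "A \<inter> B = {}" "A \<inter> C = {}" "B \<inter> C = {}"
    and "\<Gamma> \<in> feynman_classes A" "\<Gamma>' \<in> feynman_classes B" "\<Gamma>'' \<in> feynman_classes C"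
  shows "(b \<in> A \<and> c \<in> A \<and> b \<noteq> c \<longrightarrow>
      nabla (A \<union> B - {b}) C c (nabla A B b (gen \<Gamma>) (gen \<Gamma>')) (gen \<Gamma>'') =
      (nabla (A \<union> C - {c}) B b (nabla A C c (gen \<Gamma>) (gen \<Gamma>'')) (gen \<Gamma>')
        :: 'a feynman_class \<Rightarrow>\<^sub>0 'k::field) \<and>
      circ (A \<union> B - {b}) C c (circ A B b (gen \<Gamma>) (gen \<Gamma>')) (gen \<Gamma>'') =
      (circ (A \<union> C - {c}) B b (circ A C c (gen \<Gamma>) (gen \<Gamma>'')) (gen \<Gamma>')
        :: 'a feynman_class \<Rightarrow>\<^sub>0 'k)) \<and>
    (b \<in> A \<and> c \<in> B \<longrightarrow>
      nabla (A \<union> B - {b}) C c (nabla A B b (gen \<Gamma>) (gen \<Gamma>')) (gen \<Gamma>'') =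
      (nabla A (B \<union> C - {c}) b (gen \<Gamma>) (nabla B C c (gen \<Gamma>') (gen \<Gamma>''))
        :: 'a feynman_class \<Rightarrow>\<^sub>0 'k) \<and>
      circ (A \<union> B - {b}) C c (circ A B b (gen \<Gamma>) (gen \<Gamma>')) (gen \<Gamma>'') =
      (circ A (B \<union> C - {c}) b (gen \<Gamma>) (circ B C c (gen \<Gamma>') (gen \<Gamma>''))
        :: 'a feynman_class \<Rightarrow>\<^sub>0 'k))"
proof (intro conjI impI; elim conjE)
  assume bc: "b \<in> A" "c \<in> A" "b \<noteq> c"
  \<comment> \<open>The vertex set of the final graphs in both orders; it contains neither
    \<open>b\<close> nor \<open>c\<close>, which makes both available as new vertices.\<close>
  define V where "V = A \<union> B - {b} \<union> C - {c}"
  have V': "A \<union> C - {c} \<union> B - {b} = V" and bcV: "b \<notin> V" "c \<notin> V" "c \<noteq> b"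
    and sub: "B \<subseteq> V" "C \<subseteq> V" "C \<inter> B = {}"
    using assms(7-9) bc by (auto simp: V_def)
  have disj: "(A \<union> B - {b}) \<inter> C = {}" "c \<in> A \<union> B - {b}"
    "(A \<union> C - {c}) \<inter> B = {}" "b \<in> A \<union> C - {c}"
    using assms(7-9) bc by auto
  have r1: "class_restrict (class_contract Z C c) B = class_restrict Z B"
    and r2: "class_restrict (class_contract Z B b) C = class_restrict Z C"
    and cc: "class_contract (class_contract Z C c) B b = class_contract (class_contract Z B b) C c"
    and cv: "class_convex Z C \<and> class_convex (class_contract Z C c) B \<longleftrightarrow>
      class_convex Z B \<and> class_convex (class_contract Z B b) C"
    if "Z \<in> feynman_classes V" for Z
    \<comment> \<open>The second instance exchanges \<open>B\<close> and \<open>C\<close> and gives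
      \<open>r2\<close>.\<close>
    using class_disjoint[OF that sub(1) assms(4) sub(2) assms(6,9) bcV(1,2) bc(3)]
      class_disjoint(1)[OF that sub(2) assms(6) sub(1) assms(4) sub(3) bcV(2,1) bcV(3)]
    by blast+
  note left = nabla_nabla_left[OF assms(1,3,4,7) bc(1) assms(5,6) disj(1,2) assms(10-12)]
    nabla_nabla_left[OF assms(1,5,6,8) bc(2) assms(3,4) disj(3,4) assms(10,12,11)]
  show "nabla (A \<union> B - {b}) C c (nabla A B b (gen \<Gamma>) (gen \<Gamma>')) (gen \<Gamma>'') =
      (nabla (A \<union> C - {c}) B b (nabla A C c (gen \<Gamma>) (gen \<Gamma>'')) (gen \<Gamma>')
        :: 'a feynman_class \<Rightarrow>\<^sub>0 'k)"
    unfolding left iterated_insertions_left[OF disj(1,2)] iterated_insertions_left[OF disj(3,4)]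
    unfolding V' V_def[symmetric]
    by (rule arg_cong[where f = "sum gen"]) (auto simp: r1 r2 cc)
  show "circ (A \<union> B - {b}) C c (circ A B b (gen \<Gamma>) (gen \<Gamma>')) (gen \<Gamma>'') =
      (circ (A \<union> C - {c}) B b (circ A C c (gen \<Gamma>) (gen \<Gamma>'')) (gen \<Gamma>')
        :: 'a feynman_class \<Rightarrow>\<^sub>0 'k)"
    unfolding left iterated_insertions_left[OF disj(1,2)] iterated_insertions_left[OF disj(3,4)]
    unfolding V' V_def[symmetric]
    \<comment> \<open>\<open>conj_cong\<close> lets the conditional equations use that
      \<open>Z\<close> is a class on \<open>V\<close>.\<close>
    by (rule arg_cong[where f = "sum gen"], rule Collect_cong) (simp add: r1 r2 cc cv cong: conj_cong; blast)
next
  assume bc: "b \<in> A" "c \<in> B"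
  define V where "V = A \<union> B - {b} \<union> C - {c}"
  \<comment> \<open>The vertex set of the graphs obtained by inserting \<open>\<Gamma>''\<close>
    into \<open>\<Gamma>'\<close>; collapsing \<open>C\<close> in it to \<open>c\<close> gives back
    \<open>B\<close>.\<close>
  define D where "D = B \<union> C - {c}"
  have V': "A \<union> D - {b} = V" and cV: "c \<notin> V"
    and sub: "D \<subseteq> V" "C \<subseteq> D" and B: "D - C \<union> {c} = B"
    using assms(7-9) bc by (auto simp: V_def D_def)
  have disj: "(A \<union> B - {b}) \<inter> C = {}" "c \<in> A \<union> B - {b}"
    "A \<inter> (B \<union> C - {c}) = {}" "B \<union> C - {c} \<noteq> {}"
    using assms(6-9) bc by auto
  note nested = class_nested[OF _ sub assms(6) cV, unfolded B]
  note both = nabla_nabla_left[OF assms(1,3,4,7) bc(1) assms(5,6) disj(1,2) assms(10-12)]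
    nabla_nabla_right[OF assms(3,5,6,9) bc(2) assms(1) disj(4,3) bc(1) assms(10-12)]
  show "nabla (A \<union> B - {b}) C c (nabla A B b (gen \<Gamma>) (gen \<Gamma>')) (gen \<Gamma>'') =
      (nabla A (B \<union> C - {c}) b (gen \<Gamma>) (nabla B C c (gen \<Gamma>') (gen \<Gamma>''))
        :: 'a feynman_class \<Rightarrow>\<^sub>0 'k)"
    unfolding both iterated_insertions_left[OF disj(1,2)]
      iterated_insertions_right[OF disj(3) bc(1) disj(4)]
    unfolding D_def[symmetric] V' V_def[symmetric]
    by (rule arg_cong[where f = "sum gen"]) (auto simp: nested(1-3))
  show "circ (A \<union> B - {b}) C c (circ A B b (gen \<Gamma>) (gen \<Gamma>')) (gen \<Gamma>'') =
      (circ A (B \<union> C - {c}) b (gen \<Gamma>) (circ B C c (gen \<Gamma>') (gen \<Gamma>''))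
        :: 'a feynman_class \<Rightarrow>\<^sub>0 'k)"
    unfolding both iterated_insertions_left[OF disj(1,2)]
      iterated_insertions_right[OF disj(3) bc(1) disj(4)]
    unfolding D_def[symmetric] V' V_def[symmetric]
    by (rule arg_cong[where f = "sum gen"], rule Collect_cong) (simp add: nested cong: conj_cong; blast)
qed

end
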